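(* Let $M\geq \frac{1}{3-2\sqrt{2}}$ and $\alpha_0>0$, and set $\lambda_n=\alpha_0M^n$ for every integer $n\geq 0$. Then there exist constants $c_0>0$, $b>0$ and $0<\delta<1$ such that, with $\Lambda=\Lambda_{M,c_0,b,\delta}:l_1\to l_2$ the bounded linear operator defined in the context and with datum $\tilde{\Lambda}=\Lambda(e_1)\in l_2$, the sequence $\{\sigma_n\}_{n\geq 0}$ given by $$\sigma_n=\sum_{j=0}^n u_j,\qquad u_j=\frac{b}{j+2}\,e_{j+2}\quad (j\geq 0),$$ coincides with the multiscale sequence associated with $X=l_1$, $H=l_2$, $\Lambda$, $\tilde{\Lambda}$, $\|\cdot\|_F$ and $\{\lambda_n\}_{n\geq0}$. That is, $u_0$ is the solution of $$\min\left\{\lambda_0\|\tilde{\Lambda}-\Lambda(u)\|_{l_2}^{2}+\|u\|_F:\ u\in l_1\right\},$$ and, for every $n\geq 1$, $u_n$ is the solution of $$\min\left\{\lambda_n\|\tilde{\Lambda}-\Lambda(\sigma_{n-1}+u)\|_{l_2}^{2}+\|u\|_F:\ u\in l_1\right\}$$ (the solution of each of these minimization problems being unique).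
   Context: All sequence spaces consist of real sequences indexed by $\mathbb{N}=\{1,2,3,\ldots\}$, and $e_j$ denotes the $j$-th standard unit sequence. Let $$F=\left\{\gamma\in l_1:\ \|\gamma\|_F:=\sum_{n=1}^{+\infty}n|\gamma_n|<+\infty\right\},$$ with the convention $\|\gamma\|_F=+\infty$ for $\gamma\in l_1\setminus F$. Definition of $\Lambda$. Given constants $M\geq 2$, $c_0>0$, $b>0$, $0<\delta<1$, put, for $j\in\mathbb{N}$, $\eta_j=\sqrt{c_0/M^j}$ and $\mu_j=-\delta\eta_j$. The operator $\Lambda=\Lambda_{M,c_0,b,\delta}:l_1\to l_2$ is defined by $\Lambda(\gamma)=\sum_{j=1}^{+\infty}\gamma_j\Lambda(e_j)$ for $\gamma\in l_1$, where $$\Lambda(e_1)=\left(\sum_{m=2}^{+\infty}\eta_me_m\right)+\mu_2e_2,$$ and, for any $j\geq 2$, $$\Lambda(e_j)=\frac{j}{b}\left(\eta_je_j+\mu_je_j-\mu_{j+1}e_{j+1}\right).$$ Multiscale sequence. Given $\Lambda$, a datum $\tilde{\Lambda}\in l_2$ and positive parameters $\lambda_n$, $n\geq0$, the multiscale sequence $\{\sigma_n\}_{n\geq 0}$ is constructed inductively: $\sigma_0=u_0$ is a solution of $\min\{\lambda_0\|\tilde{\Lambda}-\Lambda(u)\|_{l_2}^{2}+\|u\|_F:\ u\in l_1\}$; for $n\geq1$, $u_n$ is a solution of $\min\{\lambda_n\|\tilde{\Lambda}-\Lambda(\sigma_{n-1}+u)\|_{l_2}^{2}+\|u\|_F:\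 u\in l_1\}$ and $\sigma_n=\sigma_{n-1}+u_n$. The operator $\Lambda$ above is injective on $l_1$, so the minimizers, and hence the multiscale sequence, are uniquely determined. *)

theory Defs
  imports "HOL-Analysis.Analysis"
begin

text \<open>Sequences indexed by \<open>{1, 2, 3, \<dots>}\<close> are functions on \<^typ>\<open>nat\<close> that vanish at \<open>0\<close>.\<close>

typedef ell1 = "{f :: nat \<Rightarrow> real. f 0 = 0 \<and> summable (\<lambda>n. \<bar>f n\<bar>)}"
  morphisms seq1 Abs_ell1
  by (rule exI[of _ "\<lambda>_. 0"]) simp

setup_lifting type_definition_ell1

instantiation ell1 :: real_normed_vector
begin

lift_definition zero_ell1 :: ell1 is "\<lambda>_. 0" by simp

lift_definition plus_ell1 :: "ell1 \<Rightarrow> ell1 \<Rightarrow> ell1" is "\<lambda>f g n. f n + g n"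
proof -
  fix f g :: "nat \<Rightarrow> real"
  assume "f 0 = 0 \<and> summable (\<lambda>n. \<bar>f n\<bar>)" "g 0 = 0 \<and> summable (\<lambda>n. \<bar>g n\<bar>)"
  then show "f 0 + g 0 = 0 \<and> summable (\<lambda>n. \<bar>f n + g n\<bar>)"
    by (auto intro: summable_comparison_test'[OF summable_add[of "\<lambda>n. \<bar>f n\<bar>" "\<lambda>n. \<bar>g n\<bar>"], where N = 0])
qed

lift_definition uminus_ell1 :: "ell1 \<Rightarrow> ell1" is "\<lambda>f n. - f n" by simp

lift_definition minus_ell1 :: "ell1 \<Rightarrow> ell1 \<Rightarrow> ell1" is "\<lambda>f g n. f n - g n"
proof -
  fix f g :: "nat \<Rightarrow> real"
  assume "f 0 = 0 \<and> summable (\<lambda>n. \<bar>f n\<bar>)" "g 0 = 0 \<and> summable (\<lambda>n. \<bar>g n\<bar>)"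
  then show "f 0 - g 0 = 0 \<and> summable (\<lambda>n. \<bar>f n - g n\<bar>)"
    by (auto intro: summable_comparison_test'[OF summable_add[of "\<lambda>n. \<bar>f n\<bar>" "\<lambda>n. \<bar>g n\<bar>"], where N = 0])
qed

lift_definition scaleR_ell1 :: "real \<Rightarrow> ell1 \<Rightarrow> ell1" is "\<lambda>c f n. c * f n"
  by (auto simp: abs_mult intro: summable_mult)

lift_definition norm_ell1 :: "ell1 \<Rightarrow> real" is "\<lambda>f. \<Sum>n. \<bar>f n\<bar>" .

definition dist_ell1 :: "ell1 \<Rightarrow> ell1 \<Rightarrow> real" where
  "dist_ell1 x y = norm (x - y)"

definition sgn_ell1 :: "ell1 \<Rightarrow> ell1" where
  "sgn_ell1 x = inverse (norm x) *\<^sub>R x"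

definition uniformity_ell1 :: "(ell1 \<times> ell1) filter" where
  "uniformity_ell1 = (INF e\<in>{0 <..}. principal {(x, y). dist x y < e})"

definition open_ell1 :: "ell1 set \<Rightarrow> bool" where
  "open_ell1 U \<longleftrightarrow> (\<forall>x\<in>U. eventually (\<lambda>(x', y). x' = x \<longrightarrow> y \<in> U) uniformity)"

instance
proof
  fix x y z :: ell1 and a b :: real
  show "x + y + z = x + (y + z)" by transfer (simp add: add.assoc)
  show "x + y = y + x" by transfer (simp add: add.commute)
  show "0 + x = x" by transfer simp
  show "- x + x = 0" by transfer simp
  show "x - y = x + - y" by transfer simp
  show "a *\<^sub>R (x + y) = a *\<^sub>R x + a *\<^sub>R y" by transfer (simp add: distrib_left)
  show "(a + b) *\<^sub>R x = a *\<^sub>R x + b *\<^sub>R x" by transfer (simp add: distrib_right)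
  show "a *\<^sub>R b *\<^sub>R x = (a * b) *\<^sub>R x" by transfer (simp add: mult.assoc)
  show "1 *\<^sub>R x = x" by transfer simp
  show "dist x y = norm (x - y)" by (rule dist_ell1_def)
  show "sgn x = inverse (norm x) *\<^sub>R x" by (rule sgn_ell1_def)
  show "uniformity = (INF e\<in>{0 <..}. principal {(x :: ell1, y). dist x y < e})"
    by (rule uniformity_ell1_def)
  show "open U = (\<forall>x\<in>U. \<forall>\<^sub>F (x', y) in uniformity. x' = x \<longrightarrow> y \<in> U)" for U :: "ell1 set"
    by (rule open_ell1_def)
  show "norm x = 0 \<longleftrightarrow> x = 0"
    by transfer (auto simp: suminf_eq_zero_iff fun_eq_iff)
  show "norm (a *\<^sub>R x) = \<bar>a\<bar> * norm x"
    by transfer (simp add: abs_mult suminf_mult)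
  show "norm (x + y) \<le> norm x + norm y"
  proof transfer
    fix f g :: "nat \<Rightarrow> real"
    assume fg: "f 0 = 0 \<and> summable (\<lambda>n. \<bar>f n\<bar>)" "g 0 = 0 \<and> summable (\<lambda>n. \<bar>g n\<bar>)"
    then have s: "summable (\<lambda>n. \<bar>f n\<bar> + \<bar>g n\<bar>)" by (intro summable_add) auto
    then have "summable (\<lambda>n. \<bar>f n + g n\<bar>)"
      by (rule summable_comparison_test'[where N = 0]) simp
    then have "(\<Sum>n. \<bar>f n + g n\<bar>) \<le> (\<Sum>n. \<bar>f n\<bar> + \<bar>g n\<bar>)"
      using s by (intro suminf_le) auto
    then show "(\<Sum>n. \<bar>f n + g n\<bar>) \<le> (\<Sum>n. \<bar>f n\<bar>) + (\<Sum>n. \<bar>g n\<bar>)"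
      using fg by (simp add: suminf_add)
  qed
qed

end

lemma summable_mult_squares:
  fixes f g :: "nat \<Rightarrow> real"
  assumes "summable (\<lambda>n. (f n)\<^sup>2)" "summable (\<lambda>n. (g n)\<^sup>2)"
  shows "summable (\<lambda>n. f n * g n)"
proof (rule summable_comparison_test'[where N = 0])
  show "summable (\<lambda>n. (f n)\<^sup>2 + (g n)\<^sup>2)" using assms by (rule summable_add)
  show "norm (f n * g n) \<le> (f n)\<^sup>2 + (g n)\<^sup>2" for n
  proof -
    have "2 * \<bar>f n\<bar> * \<bar>g n\<bar> \<le> (f n)\<^sup>2 + (g n)\<^sup>2"
      using sum_squares_bound[of "\<bar>f n\<bar>" "\<bar>g n\<bar>"] by simp
    moreover have "0 \<le> \<bar>f n\<bar> * \<bar>g n\<bar>" by simp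
    ultimately show ?thesis unfolding real_norm_def abs_mult by linarith
  qed
qed

lemma summable_square_add:
  fixes f g :: "nat \<Rightarrow> real"
  assumes "summable (\<lambda>n. (f n)\<^sup>2)" "summable (\<lambda>n. (g n)\<^sup>2)"
  shows "summable (\<lambda>n. (f n + g n)\<^sup>2)"
  unfolding power2_sum
  using assms summable_mult[OF summable_mult_squares[OF assms], of 2]
  by (auto intro!: summable_add simp: mult.assoc)

typedef ell2 = "{f :: nat \<Rightarrow> real. f 0 = 0 \<and> summable (\<lambda>n. (f n)\<^sup>2)}"
  morphisms seq2 Abs_ell2
  by (rule exI[of _ "\<lambda>_. 0"]) simp

setup_lifting type_definition_ell2

instantiation ell2 :: real_inner
begin

lift_definition zero_ell2 :: ell2 is "\<lambda>_. 0" by simp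

lift_definition plus_ell2 :: "ell2 \<Rightarrow> ell2 \<Rightarrow> ell2" is "\<lambda>f g n. f n + g n"
  by (auto intro: summable_square_add)

lift_definition uminus_ell2 :: "ell2 \<Rightarrow> ell2" is "\<lambda>f n. - f n" by simp

lift_definition minus_ell2 :: "ell2 \<Rightarrow> ell2 \<Rightarrow> ell2" is "\<lambda>f g n. f n - g n"
proof -
  fix f g :: "nat \<Rightarrow> real"
  assume "f 0 = 0 \<and> summable (\<lambda>n. (f n)\<^sup>2)" "g 0 = 0 \<and> summable (\<lambda>n. (g n)\<^sup>2)"
  then show "f 0 - g 0 = 0 \<and> summable (\<lambda>n. (f n - g n)\<^sup>2)"
    using summable_square_add[of f "\<lambda>n. - g n"] by auto
qed

lift_definition scaleR_ell2 :: "real \<Rightarrow> ell2 \<Rightarrow> ell2" is "\<lambda>c f n. c * f n"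
  by (auto simp: power_mult_distrib intro: summable_mult)

lift_definition inner_ell2 :: "ell2 \<Rightarrow> ell2 \<Rightarrow> real" is "\<lambda>f g. \<Sum>n. f n * g n" .

definition norm_ell2 :: "ell2 \<Rightarrow> real" where
  "norm_ell2 x = sqrt (inner x x)"

definition dist_ell2 :: "ell2 \<Rightarrow> ell2 \<Rightarrow> real" where
  "dist_ell2 x y = norm (x - y)"

definition sgn_ell2 :: "ell2 \<Rightarrow> ell2" where
  "sgn_ell2 x = inverse (norm x) *\<^sub>R x"

definition uniformity_ell2 :: "(ell2 \<times> ell2) filter" where
  "uniformity_ell2 = (INF e\<in>{0 <..}. principal {(x, y). dist x y < e})"

definition open_ell2 :: "ell2 set \<Rightarrow> bool" where
  "open_ell2 U \<longleftrightarrow> (\<forall>x\<in>U. eventually (\<lambda>(x', y). x' = x \<longrightarrow> y \<in> U) uniformity)"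

instance
proof
  fix x y z :: ell2 and a b :: real
  show "x + y + z = x + (y + z)" by transfer (simp add: add.assoc)
  show "x + y = y + x" by transfer (simp add: add.commute)
  show "0 + x = x" by transfer simp
  show "- x + x = 0" by transfer simp
  show "x - y = x + - y" by transfer simp
  show "a *\<^sub>R (x + y) = a *\<^sub>R x + a *\<^sub>R y" by transfer (simp add: distrib_left)
  show "(a + b) *\<^sub>R x = a *\<^sub>R x + b *\<^sub>R x" by transfer (simp add: distrib_right)
  show "a *\<^sub>R b *\<^sub>R x = (a * b) *\<^sub>R x" by transfer (simp add: mult.assoc)
  show "1 *\<^sub>R x = x" by transfer simp
  show "dist x y = norm (x - y)" by (rule dist_ell2_def)
  show "sgn x = inverse (norm x) *\<^sub>R x" by (rule sgn_ell2_def)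
  show "uniformity = (INF e\<in>{0 <..}. principal {(x :: ell2, y). dist x y < e})"
    by (rule uniformity_ell2_def)
  show "open U = (\<forall>x\<in>U. \<forall>\<^sub>F (x', y) in uniformity. x' = x \<longrightarrow> y \<in> U)" for U :: "ell2 set"
    by (rule open_ell2_def)
  show "norm x = sqrt (inner x x)" by (rule norm_ell2_def)
  show "inner x y = inner y x" by transfer (simp add: mult.commute)
  show "inner (x + y) z = inner x z + inner y z"
    by transfer (simp add: distrib_right suminf_add summable_mult_squares)
  show "inner (a *\<^sub>R x) y = a * inner x y"
    by transfer (simp add: mult.assoc suminf_mult summable_mult_squares)
  show "0 \<le> inner x x"
    by transfer (simp add: suminf_nonneg flip: power2_eq_square)
  show "inner x x = 0 \<longleftrightarrow> x = 0"
    by transfer (auto simp: suminf_eq_zero_iff fun_eq_iff simp flip: power2_eq_square)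
qed

end

text \<open>Unit sequences; only indices \<open>j \<ge> 1\<close> are meaningful, and index \<open>0\<close> gives the zero sequence.\<close>

lift_definition unit1 :: "nat \<Rightarrow> ell1" is "\<lambda>j n. if n = j \<and> n \<noteq> 0 then 1 else 0"
proof -
  fix j
  have "summable (\<lambda>n. \<bar>if n = j \<and> n \<noteq> 0 then 1 else (0::real)\<bar>)"
    by (rule summable_finite[of "{j}"]) auto
  then show "(if 0 = j \<and> (0::nat) \<noteq> 0 then 1 else (0::real)) = 0 \<and>
      summable (\<lambda>n. \<bar>if n = j \<and> n \<noteq> 0 then 1 else (0::real)\<bar>)" by simp
qed

lift_definition unit2 :: "nat \<Rightarrow> ell2" is "\<lambda>j n. if n = j \<and> n \<noteq> 0 then 1 else 0"
proof -
  fix j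
  have "summable (\<lambda>n. (if n = j \<and> n \<noteq> 0 then 1 else (0::real))\<^sup>2)"
    by (rule summable_finite[of "{j}"]) auto
  then show "(if 0 = j \<and> (0::nat) \<noteq> 0 then 1 else (0::real)) = 0 \<and>
      summable (\<lambda>n. (if n = j \<and> n \<noteq> 0 then 1 else (0::real))\<^sup>2)" by simp
qed

definition F_space :: "ell1 set" where
  "F_space = {\<gamma>. summable (\<lambda>n. real n * \<bar>seq1 \<gamma> n\<bar>)}"

definition F_norm :: "ell1 \<Rightarrow> ereal" where
  "F_norm \<gamma> = (if \<gamma> \<in> F_space then ereal (\<Sum>n. real n * \<bar>seq1 \<gamma> n\<bar>) else \<infinity>)"

definition eta :: "real \<Rightarrow> real \<Rightarrow> nat \<Rightarrow> real" where
  "eta M c0 j = sqrt (c0 / M ^ j)"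

definition mu :: "real \<Rightarrow> real \<Rightarrow> real \<Rightarrow> nat \<Rightarrow> real" where
  "mu M c0 \<delta> j = - \<delta> * eta M c0 j"

text \<open>The images \<open>\<Lambda>(e\<^sub>j)\<close>, for \<open>j \<ge> 1\<close>.\<close>

definition Lambda_unit :: "real \<Rightarrow> real \<Rightarrow> real \<Rightarrow> real \<Rightarrow> nat \<Rightarrow> ell2" where
  "Lambda_unit M c0 b \<delta> j =
    (if j = 1
     then (\<Sum>m. eta M c0 (m + 2) *\<^sub>R unit2 (m + 2)) + mu M c0 \<delta> 2 *\<^sub>R unit2 2
     else (real j / b) *\<^sub>R (eta M c0 j *\<^sub>R unit2 j + mu M c0 \<delta> j *\<^sub>R unit2 j
                             - mu M c0 \<delta> (j + 1) *\<^sub>R unit2 (j + 1)))"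

definition Lambda :: "real \<Rightarrow> real \<Rightarrow> real \<Rightarrow> real \<Rightarrow> ell1 \<Rightarrow> ell2" where
  "Lambda M c0 b \<delta> \<gamma> = (\<Sum>i. seq1 \<gamma> (i + 1) *\<^sub>R Lambda_unit M c0 b \<delta> (i + 1))"

lemma Lambda_unit1:
  assumes "j \<ge> 1"
  shows "Lambda M c0 b \<delta> (unit1 j) = Lambda_unit M c0 b \<delta> j"
proof -
  have "Lambda M c0 b \<delta> (unit1 j) =
      (\<Sum>i\<in>{j - 1}. seq1 (unit1 j) (i + 1) *\<^sub>R Lambda_unit M c0 b \<delta> (i + 1))"
    unfolding Lambda_def by (rule suminf_finite) (auto simp: unit1.rep_eq)
  also have "\<dots> = Lambda_unit M c0 b \<delta> j"
    using assms by (simp add: unit1.rep_eq)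
  finally show ?thesis .
qed

definition is_minimizer :: "('a \<Rightarrow> ereal) \<Rightarrow> 'a \<Rightarrow> bool" where
  "is_minimizer f u \<longleftrightarrow> is_arg_min f (\<lambda>_. True) u"

definition multiscale_sequence ::
  "('x::real_normed_vector \<Rightarrow> 'h::real_inner) \<Rightarrow> 'h \<Rightarrow> ('x \<Rightarrow> ereal) \<Rightarrow> (nat \<Rightarrow> real) \<Rightarrow> (nat \<Rightarrow> 'x) \<Rightarrow> bool"
where
  "multiscale_sequence L d R lam \<sigma> \<longleftrightarrow>
    is_minimizer (\<lambda>u. ereal (lam 0 * (norm (d - L u))\<^sup>2) + R u) (\<sigma> 0) \<and>
    (\<forall>n\<ge>1. \<exists>u. is_minimizer (\<lambda>u. ereal (lam n * (norm (d - L (\<sigma> (n - 1) + u)))\<^sup>2) + R u) u \<and>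
                \<sigma> n = \<sigma> (n - 1) + u)"

end

theory Submission imports Defs begin

text \<open>
  Let \<open>R\<^sub>N\<close> (\<open>tail N\<close> below) be the sequence with entry \<open>(1 - \<delta>) \<eta>\<^sub>N\<close> at \<open>N\<close>, entries \<open>\<eta>\<^sub>k\<close> at \<open>k > N\<close> and
  zeros before \<open>N\<close>. The operator is made so that \<open>\<Lambda>(e\<^sub>1) = R\<^sub>2\<close> and
  \<open>\<Lambda>(e\<^sub>j) = (j / b) (R\<^sub>j - R\<^sub>j\<^sub>+\<^sub>1)\<close> for \<open>j \<ge> 2\<close>. Hence each increment \<open>(b / j) e\<^sub>j\<close> replaces the residual
  \<open>R\<^sub>j\<close> by \<open>R\<^sub>j\<^sub>+\<^sub>1\<close>, and the residual of \<open>\<sigma>\<^sub>n\<close> is \<open>R\<^sub>N\<close> with \<open>N = n + 3\<close>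
  (\<open>tail_sub_partial_sum\<close>).

  Every step is a convex problem: a quadratic plus a weighted \<open>l\<^sub>1\<close> norm. Its minimizer is
  characterized by a subgradient condition, and is unique because \<open>\<Lambda>\<close> is injective
  (\<open>minimizer_iff\<close>, \<open>Lambda_eq_0D\<close>). For the increment of step \<open>n\<close> the condition says that
  \<open>2 \<lambda>\<^sub>n |\<langle>R\<^sub>N, \<Lambda>(e\<^sub>i)\<rangle>| \<le> i\<close> for all \<open>i \<ge> 1\<close>, with equality and positive inner product at
  \<open>i = N - 1\<close>. As \<open>\<eta>\<^sub>N\<^sup>2\<close> is \<open>c\<^sub>0\<close> divided by the \<open>N\<close>-th power of \<open>M\<close>, the product
  \<open>q = 2 \<lambda>\<^sub>n \<eta>\<^sub>N\<^sup>2\<close> is the same for all \<open>n\<close>, and the conditions do not depend on \<open>n\<close>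
  (\<open>minimizer_tail_iff\<close>). Equality at \<open>i = N - 1\<close> fixes \<open>b = q \<delta> (1 - \<delta>)\<close>; the condition
  at \<open>i = 1\<close> only asks that \<open>c\<^sub>0\<close> be small; the decisive one, at \<open>i = N\<close>, is
  \<open>(1 - \<delta>)\<^sup>2 + \<delta> / M \<le> \<delta> (1 - \<delta>)\<close>, a quadratic inequality for \<open>\<delta>\<close> that is solvable precisely
  for the given range of \<open>M\<close> (\<open>delta_conditions\<close>).
\<close>

section \<open>The spaces of summable and of square summable sequences\<close>

text \<open>Coordinates are inner products with the unit sequences; thus every coordinate is a bounded
  linear functional and passes through infinite sums.\<close>

lemma inner_unit2: "inner x (unit2 k) = seq2 x k"
proof transfer
  fix f :: "nat \<Rightarrow> real" and k :: nat
  assume f: "f 0 = 0 \<and> summable (\<lambda>n. (f n)\<^sup>2)"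
  have "(\<Sum>n. f n * (if n = k \<and> n \<noteq> 0 then 1 else 0))
      = (\<Sum>n\<in>{k}. f n * (if n = k \<and> n \<noteq> 0 then 1 else 0))"
    by (rule suminf_finite) auto
  then show "(\<Sum>n. f n * (if n = k \<and> n \<noteq> 0 then 1 else 0)) = f k"
    using f by auto
qed

lemma summable_seq2: "summable (\<lambda>n. (seq2 x n)\<^sup>2)"
  using seq2[of x] by simp

lemma summable_seq1: "summable (\<lambda>n. \<bar>seq1 x n\<bar>)"
  using seq1[of x] by simp

lemma seq1_0 [simp]: "seq1 x 0 = 0"
  using seq1[of x] by simp

lemma seq2_0 [simp]: "seq2 x 0 = 0"
  using seq2[of x] by simp

lemma norm_ell2_squared: "(norm x)\<^sup>2 = (\<Sum>n. (seq2 x n)\<^sup>2)" for x :: ell2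
  unfolding power2_norm_eq_inner inner_ell2.rep_eq by (simp add: power2_eq_square)

lemma abs_seq2_le_norm: "\<bar>seq2 x n\<bar> \<le> norm x"
proof -
  have "(seq2 x n)\<^sup>2 \<le> (norm x)\<^sup>2"
    unfolding norm_ell2_squared
    using sum_le_suminf[OF summable_seq2[of x], of "{n}"] by simp
  then show ?thesis
    by (metis abs_le_square_iff abs_norm_cancel)
qed

lemma seq2_sum: "seq2 (sum f A) n = (\<Sum>i\<in>A. seq2 (f i) n)"
  by (simp add: inner_sum_left flip: inner_unit2)

lemma seq1_sum: "seq1 (sum f A) n = (\<Sum>i\<in>A. seq1 (f i) n)"
  by (induction A rule: infinite_finite_induct) (auto simp: zero_ell1.rep_eq plus_ell1.rep_eq)

lemma ell1_eqI: "x = y" if "\<And>n. n \<ge> 1 \<Longrightarrow> seq1 x n = seq1 y n"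
proof -
  have "seq1 x n = seq1 y n" for n
    using that[of n] by (cases n) auto
  then show ?thesis by (metis seq1_inject ext)
qed

lemma ell2_eqI: "x = y" if "\<And>n. n \<ge> 1 \<Longrightarrow> seq2 x n = seq2 y n"
proof -
  have "seq2 x n = seq2 y n" for n
    using that[of n] by (cases n) auto
  then show ?thesis by (metis seq2_inject ext)
qed

text \<open>Completeness is what makes the series that defines \<open>\<Lambda>\<close> converge. The limit of a Cauchy
  sequence is taken coordinatewise; passing to the limit in finite sections of the squared
  distance keeps the Cauchy estimate with a bound that does not depend on the length of the
  section.\<close>

instance ell2 :: banach
proof
  fix X :: "nat \<Rightarrow> ell2"
  assume X: "Cauchy X"
  have "Cauchy (\<lambda>m. seq2 (X m) n)" for n
  proof (rule metric_CauchyI)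
    fix e :: real assume "e > 0"
    then obtain K where K: "\<And>m k. m \<ge> K \<Longrightarrow> k \<ge> K \<Longrightarrow> dist (X m) (X k) < e"
      using X unfolding Cauchy_def by blast
    have "dist (seq2 (X m) n) (seq2 (X k) n) < e" if "m \<ge> K" "k \<ge> K" for m k
      using abs_seq2_le_norm[of "X m - X k" n] K[OF that]
      by (simp add: minus_ell2.rep_eq dist_norm dist_ell2_def)
    then show "\<exists>K. \<forall>m\<ge>K. \<forall>k\<ge>K. dist (seq2 (X m) n) (seq2 (X k) n) < e" by blast
  qed
  then have "\<forall>n. \<exists>l. (\<lambda>m. seq2 (X m) n) \<longlonglongrightarrow> l"
    by (simp add: Cauchy_convergent_iff convergent_def)
  then obtain f where f: "\<And>n. (\<lambda>m. seq2 (X m) n) \<longlonglongrightarrow> f n" by metis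
  have f0: "f 0 = 0" using f[of 0] by (simp add: LIMSEQ_const_iff)
  have close: "\<exists>K. \<forall>m\<ge>K. \<forall>N. (\<Sum>n<N. (seq2 (X m) n - f n)\<^sup>2) \<le> e\<^sup>2" if e: "e > 0" for e :: real
  proof -
    obtain K where K: "\<And>m k. m \<ge> K \<Longrightarrow> k \<ge> K \<Longrightarrow> dist (X m) (X k) < e"
      using X e unfolding Cauchy_def by blast
    have "(\<Sum>n<N. (seq2 (X m) n - f n)\<^sup>2) \<le> e\<^sup>2" if m: "m \<ge> K" for m N
    proof (rule LIMSEQ_le_const2)
      show "(\<lambda>k. \<Sum>n<N. (seq2 (X m) n - seq2 (X k) n)\<^sup>2) \<longlonglongrightarrow> (\<Sum>n<N. (seq2 (X m) n - f n)\<^sup>2)"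
        by (intro tendsto_intros f)
      have "(\<Sum>n<N. (seq2 (X m) n - seq2 (X k) n)\<^sup>2) \<le> e\<^sup>2" if k: "k \<ge> K" for k
      proof -
        have "(\<Sum>n<N. (seq2 (X m) n - seq2 (X k) n)\<^sup>2) \<le> (norm (X m - X k))\<^sup>2"
          unfolding norm_ell2_squared
          using sum_le_suminf[OF summable_seq2[of "X m - X k"], of "{..<N}"]
          by (simp add: minus_ell2.rep_eq)
        also have "\<dots> \<le> e\<^sup>2"
          using K[OF m k] by (intro power_mono) (auto simp: dist_norm dist_ell2_def)
        finally show ?thesis .
      qed
      then show "\<exists>K'. \<forall>k\<ge>K'. (\<Sum>n<N. (seq2 (X m) n - seq2 (X k) n)\<^sup>2) \<le> e\<^sup>2" by blast
    qed
    then show ?thesis by blast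
  qed
  have summ: "summable (\<lambda>n. (seq2 (X m) n - f n)\<^sup>2)"
    if "\<forall>N. (\<Sum>n<N. (seq2 (X m) n - f n)\<^sup>2) \<le> e\<^sup>2" for m and e :: real
    by (rule summableI_nonneg_bounded[where x = "e\<^sup>2"]) (use that in auto)
  obtain K where K: "\<forall>N. (\<Sum>n<N. (seq2 (X K) n - f n)\<^sup>2) \<le> 1\<^sup>2"
    using close[of 1] by auto
  have "summable (\<lambda>n. (f n)\<^sup>2)"
    using summable_square_add[OF summable_seq2[of "- X K"] summ[OF K]]
    by (simp add: uminus_ell2.rep_eq)
  then have lim: "seq2 (Abs_ell2 f) = f"
    using f0 by (simp add: Abs_ell2_inverse)
  have "X \<longlonglongrightarrow> Abs_ell2 f"
  proof (rule LIMSEQ_I)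
    fix r :: real assume r: "r > 0"
    obtain K where K: "\<forall>m\<ge>K. \<forall>N. (\<Sum>n<N. (seq2 (X m) n - f n)\<^sup>2) \<le> (r/2)\<^sup>2"
      using close[of "r/2"] r by auto
    have "norm (X m - Abs_ell2 f) < r" if "m \<ge> K" for m
    proof -
      have b: "\<forall>N. (\<Sum>n<N. (seq2 (X m) n - f n)\<^sup>2) \<le> (r/2)\<^sup>2" using K that by blast
      have "(norm (X m - Abs_ell2 f))\<^sup>2 \<le> (r/2)\<^sup>2"
        unfolding norm_ell2_squared minus_ell2.rep_eq lim
        by (rule suminf_le_const[OF summ[OF b]]) (use b in auto)
      then have "norm (X m - Abs_ell2 f) \<le> r/2"
        using r by (simp add: power2_le_iff_abs_le)
      then show ?thesis using r by simp
    qed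
    then show "\<exists>K. \<forall>m\<ge>K. norm (X m - Abs_ell2 f) < r" by blast
  qed
  then show "convergent X" by (auto simp: convergent_def)
qed

lemma unit2_sums: "(\<lambda>n. seq2 x n *\<^sub>R unit2 n) sums x"
  unfolding sums_def
proof (rule LIM_zero_cancel, rule tendsto_norm_zero_cancel)
  let ?S = "\<lambda>K. \<Sum>n<K. seq2 x n *\<^sub>R unit2 n"
  have S: "seq2 (?S K) n = (if n < K then seq2 x n else 0)" for K n
  proof -
    have "seq2 (?S K) n = (\<Sum>i<K. if i = n then seq2 x n else 0)"
      unfolding seq2_sum by (rule sum.cong) (auto simp: scaleR_ell2.rep_eq unit2.rep_eq)
    then show ?thesis by simp
  qed
  have "(norm (?S K - x))\<^sup>2 = (\<Sum>n. (seq2 x (n + K))\<^sup>2)" for K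
  proof -
    have "(norm (?S K - x))\<^sup>2 = (\<Sum>n. (seq2 (?S K - x) (n + K))\<^sup>2)
        + (\<Sum>n<K. (seq2 (?S K - x) n)\<^sup>2)"
      unfolding norm_ell2_squared by (rule suminf_split_initial_segment[OF summable_seq2])
    then show ?thesis by (simp add: minus_ell2.rep_eq S)
  qed
  then have "(\<lambda>K. (norm (?S K - x))\<^sup>2) \<longlonglongrightarrow> 0"
    using suminf_exist_split2[OF summable_seq2[of x]] by simp
  then have "(\<lambda>K. sqrt ((norm (?S K - x))\<^sup>2)) \<longlonglongrightarrow> sqrt 0"
    by (rule tendsto_real_sqrt)
  then show "(\<lambda>K. norm (?S K - x)) \<longlonglongrightarrow> 0" by simp
qed

lemma unit1_sums: "(\<lambda>n. seq1 x n *\<^sub>R unit1 n) sums x"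
  unfolding sums_def
proof (rule LIM_zero_cancel, rule tendsto_norm_zero_cancel)
  let ?S = "\<lambda>K. \<Sum>n<K. seq1 x n *\<^sub>R unit1 n"
  have S: "seq1 (?S K) n = (if n < K then seq1 x n else 0)" for K n
  proof -
    have "seq1 (?S K) n = (\<Sum>i<K. if i = n then seq1 x n else 0)"
      unfolding seq1_sum by (rule sum.cong) (auto simp: scaleR_ell1.rep_eq unit1.rep_eq)
    then show ?thesis by simp
  qed
  have "norm (?S K - x) = (\<Sum>n. \<bar>seq1 x (n + K)\<bar>)" for K
  proof -
    have "norm (?S K - x) = (\<Sum>n. \<bar>seq1 (?S K - x) (n + K)\<bar>) + (\<Sum>n<K. \<bar>seq1 (?S K - x) n\<bar>)"
      unfolding norm_ell1.rep_eq by (rule suminf_split_initial_segment[OF summable_seq1])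
    then show ?thesis by (simp add: minus_ell1.rep_eq S)
  qed
  then show "(\<lambda>K. norm (?S K - x)) \<longlonglongrightarrow> 0"
    using suminf_exist_split2[OF summable_seq1[of x]] by simp
qed

text \<open>A bounded linear map on \<open>l\<^sub>1\<close> is determined by the images of the unit sequences. This reduces
  both the optimality condition and injectivity to statements about single unit sequences.\<close>

lemma bounded_linear_unit1_sums:
  assumes "bounded_linear L"
  shows "(\<lambda>n. seq1 x n *\<^sub>R L (unit1 n)) sums L x"
  using bounded_linear.sums[OF assms unit1_sums[of x]]
  by (simp add: linear_cmul[OF bounded_linear.linear[OF assms]])

lemma bounded_linear_ell1_series:
  fixes v :: "nat \<Rightarrow> 'b::banach"
  assumes v: "\<And>i. norm (v i) \<le> C"
  shows "bounded_linear (\<lambda>x. \<Sum>i. seq1 x (i + 1) *\<^sub>R v i)"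
proof -
  have n: "norm x = (\<Sum>i. \<bar>seq1 x (i + 1)\<bar>)" for x
    using suminf_split_initial_segment[OF summable_seq1[of x], of 1] by (simp add: norm_ell1.rep_eq)
  have s1: "summable (\<lambda>i. \<bar>seq1 x (i + 1)\<bar> * C)" for x
    using summable_seq1[of x] by (intro summable_mult2) (subst summable_iff_shift)
  have le: "norm (seq1 x (i + 1) *\<^sub>R v i) \<le> \<bar>seq1 x (i + 1)\<bar> * C" for x i
    using v[of i] by (simp add: mult_left_mono)
  have sn: "summable (\<lambda>i. norm (seq1 x (i + 1) *\<^sub>R v i))" for x
    by (rule summable_comparison_test'[OF s1[of x], where N = 0]) (use le in simp)
  note s = summable_norm_cancel[OF sn]
  show ?thesis
  proof (rule bounded_linear_intro[where K = C])
    fix x y :: ell1 and r :: real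
    show "(\<Sum>i. seq1 (x + y) (i + 1) *\<^sub>R v i)
        = (\<Sum>i. seq1 x (i + 1) *\<^sub>R v i) + (\<Sum>i. seq1 y (i + 1) *\<^sub>R v i)"
      by (simp only: suminf_add[OF s s] plus_ell1.rep_eq scaleR_add_left)
    show "(\<Sum>i. seq1 (r *\<^sub>R x) (i + 1) *\<^sub>R v i) = r *\<^sub>R (\<Sum>i. seq1 x (i + 1) *\<^sub>R v i)"
      by (simp only: suminf_scaleR_right[OF s] scaleR_ell1.rep_eq scaleR_scaleR)
    have "norm (\<Sum>i. seq1 x (i + 1) *\<^sub>R v i) \<le> (\<Sum>i. \<bar>seq1 x (i + 1)\<bar> * C)"
      using summable_norm[OF sn[of x]] suminf_le[OF le sn s1] by (rule order_trans)
    also have "\<dots> = norm x * C"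
      unfolding n using summable_seq1[of x] by (intro suminf_mult2[symmetric]) (subst summable_iff_shift)
    finally show "norm (\<Sum>i. seq1 x (i + 1) *\<^sub>R v i) \<le> norm x * C" .
  qed
qed

section \<open>Optimality for the weighted norm\<close>

text \<open>The dual unit ball of \<open>\<parallel>\<cdot>\<parallel>\<^sub>F\<close>: since \<open>\<parallel>\<cdot>\<parallel>\<^sub>F\<close> is a weighted \<open>l\<^sub>1\<close> norm, a functional is bounded
  by it as soon as its value at each \<open>e\<^sub>j\<close> is bounded by the weight \<open>j\<close>.\<close>

lemma inner_le_F_norm:
  fixes L :: "ell1 \<Rightarrow> 'h::real_inner"
  assumes L: "bounded_linear L"
    and le: "\<And>j. j \<ge> 1 \<Longrightarrow> \<bar>inner p (L (unit1 j))\<bar> \<le> real j"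
    and w: "w \<in> F_space"
  shows "inner p (L w) \<le> (\<Sum>n. real n * \<bar>seq1 w n\<bar>)"
proof -
  have s: "(\<lambda>n. seq1 w n * inner p (L (unit1 n))) sums inner p (L w)"
    using bounded_linear.sums[OF bounded_linear_inner_right bounded_linear_unit1_sums[OF L, of w]]
    by simp
  have "seq1 w n * inner p (L (unit1 n)) \<le> real n * \<bar>seq1 w n\<bar>" for n
  proof (cases "n = 0")
    case False
    have "seq1 w n * inner p (L (unit1 n)) \<le> \<bar>seq1 w n\<bar> * \<bar>inner p (L (unit1 n))\<bar>"
      by (metis abs_ge_self abs_mult)
    also have "\<dots> \<le> \<bar>seq1 w n\<bar> * real n"
      using le[of n] False by (intro mult_left_mono) auto
    finally show ?thesis by (simp add: mult.commute)
  qed simp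
  then show ?thesis
    using s w by (metis (mono_tags, lifting) F_space_def mem_Collect_eq sums_iff suminf_le)
qed

text \<open>The first-order optimality condition, with uniqueness. The hypotheses say that
  \<open>2 \<lambda> L\<^sup>*(d - L u)\<close> is a subgradient of \<open>\<parallel>\<cdot>\<parallel>\<^sub>F\<close> at \<open>u\<close>: it lies in the dual unit ball and attains
  the norm at \<open>u\<close>. Expanding the square around \<open>u\<close> then shows that the functional at \<open>w\<close> exceeds
  its value at \<open>u\<close> by at least \<open>\<lambda> \<parallel>L (w - u)\<parallel>\<^sup>2\<close>, which vanishes only at \<open>w = u\<close> when \<open>L\<close> is
  injective.\<close>

lemma minimizer_iff:
  fixes L :: "ell1 \<Rightarrow> 'h::real_inner"
  assumes L: "bounded_linear L" and inj: "\<And>h. L h = 0 \<Longrightarrow> h = 0" and lam: "lam > 0"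
    and le: "\<And>j. j \<ge> 1 \<Longrightarrow> 2 * lam * \<bar>inner (d - L u) (L (unit1 j))\<bar> \<le> real j"
    and eq: "F_norm u = ereal (2 * lam * inner (d - L u) (L u))"
  shows "is_minimizer (\<lambda>w. ereal (lam * (norm (d - L w))\<^sup>2) + F_norm w) v \<longleftrightarrow> v = u"
proof -
  let ?J = "\<lambda>w. ereal (lam * (norm (d - L w))\<^sup>2) + F_norm w"
  interpret L: bounded_linear L by (rule L)
  define r where "r = d - L u"
  have gap: "?J u + ereal (lam * (norm (L (w - u)))\<^sup>2) \<le> ?J w" for w
  proof (cases "w \<in> F_space")
    case True
    have "inner ((2 * lam) *\<^sub>R r) (L w) \<le> (\<Sum>n. real n * \<bar>seq1 w n\<bar>)"
      by (rule inner_le_F_norm[OF L _ True]) (use le lam in \<open>auto simp: abs_mult r_def\<close>)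
    moreover have "lam * (norm (d - L w))\<^sup>2
        = lam * (norm r)\<^sup>2 - 2 * lam * inner r (L (w - u)) + lam * (norm (L (w - u)))\<^sup>2"
    proof -
      have w: "d - L w = r - L (w - u)" by (simp add: r_def L.diff)
      show ?thesis
        unfolding w by (simp add: power2_norm_eq_inner inner_diff_left inner_diff_right inner_commute
            algebra_simps)
    qed
    ultimately have "lam * (norm r)\<^sup>2 + 2 * lam * inner r (L u) + lam * (norm (L (w - u)))\<^sup>2
        \<le> lam * (norm (d - L w))\<^sup>2 + (\<Sum>n. real n * \<bar>seq1 w n\<bar>)"
      unfolding L.diff[of w u] inner_diff_right right_diff_distrib inner_scaleR_left by linarith
    then show ?thesis using True eq by (simp add: F_norm_def r_def)
  qed (simp add: F_norm_def)
  have fin: "?J u = ereal (lam * (norm (d - L u))\<^sup>2 + 2 * lam * inner (d - L u) (L u))"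
    using eq by simp
  have "?J u \<le> ?J w" for w
    by (rule order_trans[OF _ gap[of w]]) (use lam fin in simp)
  then have 1: "is_minimizer ?J u"
    by (auto simp: is_minimizer_def is_arg_min_def not_less)
  have "v = u" if "is_minimizer ?J v"
  proof -
    have "?J v \<le> ?J u"
      using that by (auto simp: is_minimizer_def is_arg_min_def not_less)
    then have "?J u + ereal (lam * (norm (L (v - u)))\<^sup>2) \<le> ?J u"
      using gap[of v] by (rule order_trans[rotated])
    then have "lam * (norm (L (v - u)))\<^sup>2 \<le> 0" unfolding fin by simp
    then have "L (v - u) = 0" using lam by (simp add: mult_le_0_iff)
    then show ?thesis using inj by force
  qed
  then show ?thesis using 1 by blast
qed

lemma multiscale_sequence_unique:
  assumes base: "\<And>v. is_minimizer (\<lambda>w. ereal (lam 0 * (norm (d - L w))\<^sup>2) + R w) v \<longleftrightarrow> v = \<sigma> 0"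
    and step: "\<And>n v. n \<ge> 1 \<Longrightarrow>
      is_minimizer (\<lambda>w. ereal (lam n * (norm (d - L (\<sigma> (n - 1) + w)))\<^sup>2) + R w) v
        \<longleftrightarrow> \<sigma> n = \<sigma> (n - 1) + v"
  shows "multiscale_sequence L d R lam \<tau> \<longleftrightarrow> \<tau> = \<sigma>"
proof
  assume \<tau>: "multiscale_sequence L d R lam \<tau>"
  have "\<tau> n = \<sigma> n" for n
  proof (induction n)
    case 0
    show ?case using \<tau> base unfolding multiscale_sequence_def by blast
  next
    case (Suc n)
    obtain u where
      u: "is_minimizer (\<lambda>u. ereal (lam (Suc n) * (norm (d - L (\<tau> n + u)))\<^sup>2) + R u) u"
      and s: "\<tau> (Suc n) = \<tau> n + u"
      using \<tau> unfolding multiscale_sequence_def by (metis diff_Suc_1 le_add1 plus_1_eq_Suc)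
    show ?case using u s Suc.IH step[of "Suc n" u] by simp
  qed
  then show "\<tau> = \<sigma>" by blast
next
  assume \<tau>: "\<tau> = \<sigma>"
  have "\<exists>u. is_minimizer (\<lambda>u. ereal (lam n * (norm (d - L (\<sigma> (n - 1) + u)))\<^sup>2) + R u) u \<and>
                \<sigma> n = \<sigma> (n - 1) + u" if "n \<ge> 1" for n
    using step[OF that, of "\<sigma> n - \<sigma> (n - 1)"] by (intro exI[of _ "\<sigma> n - \<sigma> (n - 1)"]) simp
  then show "multiscale_sequence L d R lam \<tau>"
    using base unfolding multiscale_sequence_def \<tau> by blast
qed

section \<open>The operator and its residuals\<close>

locale example_operator =
  fixes M c0 b \<delta> :: real
  assumes M: "M > 1" and c0: "c0 > 0" and b: "b > 0" and \<delta>: "0 < \<delta>" "\<delta> < 1"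
begin

abbreviation "\<eta> \<equiv> eta M c0"
abbreviation "L \<equiv> Lambda M c0 b \<delta>"

lemma eta_pos: "\<eta> j > 0"
  using M c0 by (simp add: eta_def)

lemma eta_squared: "(\<eta> j)\<^sup>2 = c0 / M ^ j"
  using M c0 by (simp add: eta_def)

lemma eta_add_squared: "(\<eta> (j + k))\<^sup>2 = (\<eta> j)\<^sup>2 * (1 / M) ^ k"
  by (simp add: eta_squared power_add power_one_over field_simps)

lemma summable_eta_squared: "summable (\<lambda>j. (\<eta> j)\<^sup>2)"
proof -
  have "summable (\<lambda>j. c0 * (1 / M) ^ j)"
    using M by (intro summable_mult summable_geometric) simp
  then show ?thesis by (simp add: eta_squared power_one_over)
qed

text \<open>All residuals of the multiscale sequence have one shape: the sequence \<open>\<eta>\<close> cut off below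
  an index \<open>N\<close>, with the entry at \<open>N\<close> damped by the factor \<open>1 - \<delta>\<close>, which is the effect of
  \<open>\<mu>\<^sub>N = -\<delta> \<eta>\<^sub>N\<close>. The entry at the dummy index \<open>0\<close> is zero even for \<open>N = 0\<close>.\<close>

definition tail_seq :: "nat \<Rightarrow> nat \<Rightarrow> real" where
  "tail_seq N k = (if k < N \<or> k = 0 then 0 else if k = N then (1 - \<delta>) * \<eta> k else \<eta> k)"

lemma tail_seq_nonneg: "0 \<le> tail_seq N k"
  using eta_pos[of k] \<delta> by (auto simp: tail_seq_def)

lemma tail_seq_le: "tail_seq N k \<le> \<eta> k"
  using eta_pos[of k] \<delta> by (auto simp: tail_seq_def mult_left_le_one_le)

definition tail :: "nat \<Rightarrow> ell2" where
  "tail N = Abs_ell2 (tail_seq N)"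

lemma seq2_tail: "seq2 (tail N) = tail_seq N"
proof -
  have "summable (\<lambda>k. (tail_seq N k)\<^sup>2)"
    by (rule summable_comparison_test'[OF summable_eta_squared, where N = 0])
      (simp add: power_mono tail_seq_nonneg tail_seq_le)
  then show ?thesis
    unfolding tail_def by (intro Abs_ell2_inverse) (simp add: tail_seq_def)
qed

text \<open>Moving the cut-off by one removes the damped entry at \<open>j\<close> and damps the entry at \<open>j + 1\<close>,
  hence leaves only two coordinates.\<close>

lemma tail_diff:
  assumes "j \<ge> 1"
  shows "tail j - tail (j + 1) = ((1 - \<delta>) * \<eta> j) *\<^sub>R unit2 j + (\<delta> * \<eta> (j + 1)) *\<^sub>R unit2 (j + 1)"
  by (rule ell2_eqI) (use assms in \<open>auto simp: minus_ell2.rep_eq plus_ell2.rep_eq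
    scaleR_ell2.rep_eq unit2.rep_eq seq2_tail tail_seq_def algebra_simps\<close>)

lemma Lambda_first_unit: "L (unit1 1) = tail 2"
proof -
  let ?x = "tail 2 - mu M c0 \<delta> 2 *\<^sub>R unit2 2"
  have x: "seq2 ?x k = (if k < 2 then 0 else \<eta> k)" for k
    by (auto simp: minus_ell2.rep_eq plus_ell2.rep_eq scaleR_ell2.rep_eq unit2.rep_eq seq2_tail
        tail_seq_def mu_def algebra_simps)
  have "(\<lambda>n. seq2 ?x (n + 2) *\<^sub>R unit2 (n + 2)) sums (?x - (\<Sum>n<2. seq2 ?x n *\<^sub>R unit2 n))"
    using unit2_sums[of ?x] by (subst sums_iff_shift) simp
  then have "(\<lambda>n. \<eta> (n + 2) *\<^sub>R unit2 (n + 2)) sums ?x" by (simp add: x)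
  then show ?thesis by (simp add: Lambda_unit1 Lambda_unit_def sums_iff)
qed

text \<open>Together with \<open>\<Lambda>(e\<^sub>1) = tail 2\<close>, this is the reason for the definition of \<open>\<Lambda>\<close>: up to scaling,
  \<open>e\<^sub>j\<close> is mapped to the difference of two consecutive residuals, so that adding a multiple of
  \<open>e\<^sub>j\<close> turns the residual \<open>tail j\<close> into \<open>tail (j + 1)\<close>.\<close>

lemma Lambda_later_unit:
  assumes "j \<ge> 2"
  shows "L (unit1 j) = (real j / b) *\<^sub>R (tail j - tail (j + 1))"
proof -
  have j: "1 \<le> j" using assms by simp
  show ?thesis
    using assms unfolding tail_diff[OF j] Lambda_unit1[OF j] Lambda_unit_def
    by (simp add: mu_def algebra_simps)
qed

text \<open>The images of the unit sequences are bounded, because the geometric decay of \<open>\<eta>\<^sub>j\<close> beats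
  the factor \<open>j\<close>.\<close>

lemma bounded_linear_Lambda: "bounded_linear L"
proof -
  let ?q = "sqrt (1 / M)"
  have "(\<lambda>j. real j * ?q ^ j) \<longlonglongrightarrow> 0"
    using M by (intro powser_times_n_limit_0) simp
  then obtain C where C: "\<And>j. norm (real j * ?q ^ j) \<le> C"
    using convergent_imp_Bseq Bseq_def convergentI by (metis BseqE)
  have eta: "real j * \<eta> j \<le> sqrt c0 * C" for j
  proof -
    have "\<eta> j = sqrt c0 * ?q ^ j"
      by (simp add: eta_def real_sqrt_divide real_sqrt_power power_divide)
    moreover have "sqrt c0 * (real j * ?q ^ j) \<le> sqrt c0 * C"
      using C[of j] c0 by (intro mult_left_mono) auto
    ultimately show ?thesis by (simp add: mult_ac)
  qed
  let ?B = "max (norm (tail 2)) (2 * (sqrt c0 * C) / b)"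
  have "norm (L (unit1 (i + 1))) \<le> ?B" for i
  proof (cases "i = 0")
    case True
    then show ?thesis using Lambda_first_unit by simp
  next
    case False
    have u: "norm (unit2 k) \<le> 1" for k
    proof -
      have "(norm (unit2 k))\<^sup>2 = seq2 (unit2 k) k"
        by (simp add: power2_norm_eq_inner inner_unit2)
      also have "\<dots> \<le> 1\<^sup>2" by (simp add: unit2.rep_eq)
      finally show ?thesis by (rule power2_le_imp_le) simp
    qed
    define j where "j = i + 1"
    have j: "j \<ge> 2" using False by (simp add: j_def)
    have "norm (tail j - tail (j + 1)) \<le> (1 - \<delta>) * \<eta> j * 1 + \<delta> * \<eta> (j + 1) * 1"
      unfolding tail_diff[OF order_trans[OF one_le_numeral j]]
      using eta_pos[of j] eta_pos[of "j + 1"] \<delta> u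
      by (intro norm_triangle_le add_mono) (simp_all add: abs_mult mult_left_le)
    also have "\<dots> \<le> \<eta> j + \<eta> (j + 1)"
      using eta_pos[of j] eta_pos[of "j + 1"] \<delta> by (intro add_mono) (simp_all add: mult_left_le_one_le)
    finally have "real j * norm (tail j - tail (j + 1)) \<le> real j * (\<eta> j + \<eta> (j + 1))"
      by (intro mult_left_mono) auto
    also have "\<dots> \<le> real j * \<eta> j + real (j + 1) * \<eta> (j + 1)"
      using eta_pos[of "j + 1"] by (simp add: algebra_simps)
    also have "\<dots> \<le> 2 * (sqrt c0 * C)" using eta[of j] eta[of "j + 1"] by simp
    finally have "norm (L (unit1 j)) \<le> 2 * (sqrt c0 * C) / b"
      using b by (simp add: Lambda_later_unit[OF j] divide_right_mono)
    then show ?thesis by (simp add: j_def)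
  qed
  then have "norm (Lambda_unit M c0 b \<delta> (i + 1)) \<le> ?B" for i
    by (metis Lambda_unit1 le_add2)
  then show ?thesis
    unfolding Lambda_def[abs_def] by (rule bounded_linear_ell1_series)
qed

lemma inner_tail_diff:
  assumes "j \<ge> 1"
  shows "inner (tail N) (tail j - tail (j + 1))
    = (1 - \<delta>) * \<eta> j * tail_seq N j + \<delta> * \<eta> (j + 1) * tail_seq N (j + 1)"
  unfolding tail_diff[OF assms] inner_add_right inner_scaleR_right inner_unit2 seq2_tail ..

text \<open>If \<open>\<Lambda>(h) = 0\<close>, the coordinates \<open>2, 3, \<dots>\<close> form a recursion whose only solution
  has \<open>j h\<^sub>j / b = -h\<^sub>1\<close> for all \<open>j \<ge> 2\<close>. So \<open>h\<close> is a multiple of the harmonic sequence beyond its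
  first entry, and being summable it must vanish. The formal sum of all increments
  \<open>(b / j) e\<^sub>j\<close> minus \<open>e\<^sub>1\<close> is exactly such a kernel element, which narrowly fails to lie in \<open>l\<^sub>1\<close>.\<close>

lemma Lambda_eq_0D:
  assumes "L h = 0"
  shows "h = 0"
proof -
  define a where "a j = seq1 h j * real j / b" for j
  have coord: "(\<lambda>j. seq1 h j * seq2 (L (unit1 j)) k) sums 0" for k
    using bounded_linear.sums[OF bounded_linear_inner_left
        bounded_linear_unit1_sums[OF bounded_linear_Lambda, of h], of "unit2 k"]
    by (simp add: assms inner_unit2 zero_ell2.rep_eq scaleR_ell2.rep_eq)
  have col: "seq1 h j * seq2 (L (unit1 j)) k =
      (if j = 1 then seq1 h 1 * tail_seq 2 k
       else if j = k then a j * (1 - \<delta>) * \<eta> k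
       else if j + 1 = k then a j * \<delta> * \<eta> k else 0)" if "k \<ge> 2" for j k
  proof -
    consider "j = 0" | "j = 1" | "j \<ge> 2" by linarith
    then show ?thesis
    proof cases
      case 2 then show ?thesis using Lambda_first_unit by (simp add: seq2_tail)
    next
      case 3 then show ?thesis
        using tail_diff[of j] that
        by (auto simp: Lambda_later_unit scaleR_ell2.rep_eq plus_ell2.rep_eq unit2.rep_eq a_def)
    qed (use that in \<open>simp add: a_def\<close>)
  qed
  \<comment> \<open>Coordinate 2 involves only \<open>h\<^sub>1\<close> and \<open>h\<^sub>2\<close>; coordinate \<open>k + 1\<close>, for \<open>k \<ge> 2\<close>, involves \<open>h\<close> only at \<open>1\<close>, \<open>k\<close> and \<open>k + 1\<close>.\<close>
  have "a k = - seq1 h 1" if "k \<ge> 2" for k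
    using that
  proof (induction k rule: dec_induct)
    case base
    have "(\<Sum>j\<in>{1,2}. seq1 h j * seq2 (L (unit1 j)) 2) = 0"
      by (rule sums_unique2[OF sums_finite coord[of 2]]) (auto simp: col)
    then have "(1 - \<delta>) * \<eta> 2 * (seq1 h 1 + a 2) = 0"
      by (simp add: col tail_seq_def algebra_simps)
    then show ?case using \<delta> eta_pos[of 2] by simp
  next
    case (step k)
    have "(\<Sum>j\<in>{1,k,Suc k}. seq1 h j * seq2 (L (unit1 j)) (Suc k)) = 0"
      by (rule sums_unique2[OF sums_finite coord[of "Suc k"]]) (use step in \<open>auto simp: col\<close>)
    then have "\<eta> (Suc k) * (seq1 h 1 + a (Suc k) * (1 - \<delta>) + a k * \<delta>) = 0"
      using step by (simp add: col tail_seq_def algebra_simps)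
    then have "seq1 h 1 + a (Suc k) * (1 - \<delta>) + a k * \<delta> = 0"
      using eta_pos[of "Suc k"] by simp
    then have "(1 - \<delta>) * (a (Suc k) + seq1 h 1) = 0"
      unfolding step.IH by algebra
    then show ?case using \<delta> by simp
  qed
  then have h: "seq1 h k = - seq1 h 1 * b * inverse (real k)" if "k \<ge> 2" for k
    using that b by (simp add: a_def field_simps)
  have h1: "seq1 h 1 = 0"
  proof (rule ccontr)
    assume n: "seq1 h 1 \<noteq> 0"
    have "summable (\<lambda>k. inverse (real k))"
    proof (rule summable_comparison_test'[where N = 2])
      show "summable (\<lambda>k. \<bar>seq1 h k\<bar> / (\<bar>seq1 h 1\<bar> * b))"
        by (intro summable_divide summable_seq1)
      show "norm (inverse (real k)) \<le> \<bar>seq1 h k\<bar> / (\<bar>seq1 h 1\<bar> * b)" if "k \<ge> 2" for k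
        using n b by (simp add: h[OF that] abs_mult)
    qed
    then show False using not_summable_harmonic[where 'a = real] by simp
  qed
  show ?thesis
  proof (rule ell1_eqI)
    fix n :: nat assume "n \<ge> 1"
    then consider "n = 1" | "n \<ge> 2" by linarith
    then show "seq1 h n = seq1 0 n"
      by cases (use h1 h in \<open>auto simp: zero_ell1.rep_eq\<close>)
  qed
qed

text \<open>Entries of a tail are at most those of \<open>\<eta>\<close>, and \<open>\<eta>\<^sup>2\<close> is geometric with ratio \<open>1 / M\<close>. The
  bound decays like the power \<open>-N\<close> of \<open>M\<close>, exactly balancing the growth of \<open>\<lambda>\<^sub>n\<close>; Cauchy-Schwarz would
  only give the power \<open>-N/2\<close>.\<close>

lemma inner_tail_le: "inner (tail N) (tail K) \<le> (\<eta> N)\<^sup>2 * (M / (M - 1))"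
proof -
  have s: "(\<lambda>k. (\<eta> (k + N))\<^sup>2) sums ((\<eta> N)\<^sup>2 * (M / (M - 1)))"
    using sums_mult[OF geometric_sums[of "1 / M"], of "(\<eta> N)\<^sup>2"] M
    by (simp add: add.commute[of _ N] eta_add_squared) (simp add: field_simps)
  have t: "summable (\<lambda>k. tail_seq N k * tail_seq K k)"
    using summable_mult_squares[OF summable_seq2[of "tail N"] summable_seq2[of "tail K"]]
    by (simp add: seq2_tail)
  have "inner (tail N) (tail K) = (\<Sum>k. tail_seq N (k + N) * tail_seq K (k + N))"
    using suminf_split_initial_segment[OF t, of N]
    by (simp add: inner_ell2.rep_eq seq2_tail) (simp add: tail_seq_def)
  also have "\<dots> \<le> (\<Sum>k. (\<eta> (k + N))\<^sup>2)"
  proof (rule suminf_le)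
    show "tail_seq N (k + N) * tail_seq K (k + N) \<le> (\<eta> (k + N))\<^sup>2" for k
      unfolding power2_eq_square
      by (intro mult_mono tail_seq_le tail_seq_nonneg less_imp_le[OF eta_pos])
    show "summable (\<lambda>k. tail_seq N (k + N) * tail_seq K (k + N))"
      using t by (rule summable_ignore_initial_segment)
  qed (use s in \<open>simp add: sums_iff\<close>)
  also have "\<dots> = (\<eta> N)\<^sup>2 * (M / (M - 1))" using s by (simp add: sums_iff)
  finally show ?thesis .
qed

lemma inner_tail_nonneg: "0 \<le> inner (tail N) (tail K)"
  unfolding inner_ell2.rep_eq seq2_tail
  by (rule suminf_nonneg)
    (use summable_mult_squares[OF summable_seq2[of "tail N"] summable_seq2[of "tail K"]]
      in \<open>auto simp: seq2_tail tail_seq_nonneg\<close>)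

section \<open>The multiscale sequence\<close>

text \<open>One step of the scheme. With the datum \<open>tail j\<close> and the candidate \<open>(b / j) e\<^sub>j\<close> the residual is
  \<open>tail N\<close>, \<open>N = j + 1\<close>, and the optimality condition has to be checked at each \<open>e\<^sub>i\<close>. The residual is
  orthogonal to \<open>\<Lambda>(e\<^sub>i)\<close> for \<open>2 \<le> i < j\<close>; \<open>active\<close> is the equality required at \<open>i = j\<close>, \<open>quad\<close> is
  the inequality at \<open>i = N\<close>, \<open>later\<close> the one at \<open>i > N\<close>, and \<open>first\<close> serves \<open>i = 1\<close>.\<close>

lemma minimizer_tail_iff:
  fixes j :: nat
  defines "u \<equiv> (b / real j) *\<^sub>R unit1 j"
  assumes j: "j \<ge> 2" and lam: "lam > 0"
    and quad: "(1 - \<delta>)\<^sup>2 + \<delta> / M \<le> \<delta> * (1 - \<delta>)"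
    and later: "(1 - \<delta> + \<delta> / M) / M \<le> \<delta> * (1 - \<delta>)"
    and active: "2 * lam * (\<eta> (j + 1))\<^sup>2 * (\<delta> * (1 - \<delta>)) = b"
    and first: "2 * lam * (\<eta> (j + 1))\<^sup>2 * (M / (M - 1)) \<le> 1"
  shows "is_minimizer (\<lambda>w. ereal (lam * (norm (tail j - L w))\<^sup>2) + F_norm w) v \<longleftrightarrow> v = u"
proof (rule minimizer_iff[OF bounded_linear_Lambda Lambda_eq_0D lam])
  interpret L: bounded_linear L by (rule bounded_linear_Lambda)
  define N where "N = j + 1"
  define q where "q = 2 * lam * (\<eta> N)\<^sup>2"
  have q: "q > 0" using lam eta_pos[of N] by (simp add: q_def)
  have qb: "q * (\<delta> * (1 - \<delta>)) = b" using active by (simp add: q_def N_def)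
  have Lu: "L u = tail j - tail N"
    using j b by (simp add: u_def N_def L.scaleR Lambda_later_unit)
  then have r: "tail j - L u = tail N" by simp
  have pos: "0 \<le> inner (tail N) (tail i - tail (i + 1))" if "i \<ge> 1" for i
    unfolding inner_tail_diff[OF that] using \<delta> eta_pos less_imp_le
    by (intro add_nonneg_nonneg mult_nonneg_nonneg) (auto simp: tail_seq_nonneg)
  have le: "2 * lam * inner (tail N) (tail i - tail (i + 1)) \<le> b" if i: "i \<ge> 2" for i
  proof -
    have i1: "1 \<le> i" using i by simp
    consider "i + 1 < N" | "i = j" | "i = N" | "i > N" unfolding N_def by linarith
    then show ?thesis
    proof cases
      case 1
      then show ?thesis using b unfolding inner_tail_diff[OF i1] by (simp add: tail_seq_def)
    next
      case 2
      have "inner (tail N) (tail i - tail (i + 1)) = \<delta> * (1 - \<delta>) * (\<eta> N)\<^sup>2"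
        using 2 j unfolding inner_tail_diff[OF i1]
        by (simp add: tail_seq_def N_def power2_eq_square)
      then show ?thesis using qb by (simp add: q_def mult_ac)
    next
      case 3
      have "inner (tail N) (tail i - tail (i + 1)) = (1 - \<delta>)\<^sup>2 * (\<eta> N)\<^sup>2 + \<delta> * (\<eta> (N + 1))\<^sup>2"
        using 3 i unfolding inner_tail_diff[OF i1] by (simp add: tail_seq_def power2_eq_square)
      also have "\<dots> = ((1 - \<delta>)\<^sup>2 + \<delta> / M) * (\<eta> N)\<^sup>2"
        unfolding eta_add_squared by (simp add: algebra_simps)
      finally have "2 * lam * inner (tail N) (tail i - tail (i + 1)) = q * ((1 - \<delta>)\<^sup>2 + \<delta> / M)"
        by (simp add: q_def)
      also have "\<dots> \<le> b" unfolding qb[symmetric] using quad q by (intro mult_left_mono) auto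
      finally show ?thesis .
    next
      case 4
      have "inner (tail N) (tail i - tail (i + 1)) = (1 - \<delta>) * (\<eta> i)\<^sup>2 + \<delta> * (\<eta> (i + 1))\<^sup>2"
        using 4 unfolding inner_tail_diff[OF i1] by (simp add: tail_seq_def power2_eq_square)
      also have "\<dots> = (1 - \<delta> + \<delta> / M) * (\<eta> i)\<^sup>2"
        unfolding eta_add_squared by (simp add: algebra_simps)
      also have "\<dots> \<le> (1 - \<delta> + \<delta> / M) * ((\<eta> N)\<^sup>2 * (1 / M))"
      proof (rule mult_left_mono)
        have "(\<eta> i)\<^sup>2 = (\<eta> N)\<^sup>2 * (1 / M) ^ (i - N)"
          using 4 eta_add_squared[of N "i - N"] by simp
        also have "(1 / M) ^ (i - N) \<le> (1 / M) ^ 1"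
          using 4 M by (intro power_decreasing) auto
        finally show "(\<eta> i)\<^sup>2 \<le> (\<eta> N)\<^sup>2 * (1 / M)" by (simp add: mult_left_mono)
      qed (use \<delta> M in auto)
      finally have "2 * lam * inner (tail N) (tail i - tail (i + 1))
          \<le> 2 * lam * ((1 - \<delta> + \<delta> / M) * ((\<eta> N)\<^sup>2 * (1 / M)))"
        using lam by (intro mult_left_mono) auto
      also have "\<dots> = q * ((1 - \<delta> + \<delta> / M) / M)" by (simp add: q_def)
      also have "\<dots> \<le> b" unfolding qb[symmetric] using later q by (intro mult_left_mono) auto
      finally show ?thesis .
    qed
  qed
  show "2 * lam * \<bar>inner (tail j - L u) (L (unit1 i))\<bar> \<le> real i" if i: "i \<ge> 1" for i
  proof (cases "i = 1")
    case True
    have "2 * lam * inner (tail N) (tail 2) \<le> 2 * lam * ((\<eta> N)\<^sup>2 * (M / (M - 1)))"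
      using lam by (intro mult_left_mono inner_tail_le) auto
    also have "\<dots> \<le> 1" using first by (simp add: N_def)
    finally show ?thesis
      using True Lambda_first_unit inner_tail_nonneg[of N 2] by (simp add: r)
  next
    case False
    then have i2: "i \<ge> 2" using i by simp
    have "2 * lam * \<bar>inner (tail j - L u) (L (unit1 i))\<bar>
        = (real i / b) * (2 * lam * inner (tail N) (tail i - tail (i + 1)))"
      using pos[OF i] b by (simp add: r Lambda_later_unit[OF i2] abs_mult)
    also have "\<dots> \<le> (real i / b) * b"
      using le[OF i2] b by (intro mult_left_mono) auto
    finally show ?thesis using b by simp
  qed
  have "inner (tail j - L u) (L u) = \<delta> * (1 - \<delta>) * (\<eta> N)\<^sup>2"
    unfolding r Lu using j inner_tail_diff[of j N]
    by (simp add: N_def tail_seq_def power2_eq_square)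
  then have "2 * lam * inner (tail j - L u) (L u) = b" using qb by (simp add: q_def mult_ac)
  moreover have "F_norm u = ereal b"
  proof -
    have "(\<lambda>n. real n * \<bar>seq1 u n\<bar>) = (\<lambda>n. if n = j then b else 0)"
      using j b by (auto simp: u_def scaleR_ell1.rep_eq unit1.rep_eq fun_eq_iff)
    moreover have "(\<lambda>n. if n = j then b else 0) sums b"
      using sums_single[of j "\<lambda>_. b"] by simp
    ultimately show ?thesis by (simp add: F_norm_def F_space_def sums_iff)
  qed
  ultimately show "F_norm u = ereal (2 * lam * inner (tail j - L u) (L u))" by simp
qed

text \<open>The images of the increments are consecutive differences of tails, so the sum telescopes.\<close>

lemma tail_sub_partial_sum:
  "tail 2 - L (\<Sum>j=0..n. (b / real (j + 2)) *\<^sub>R unit1 (j + 2)) = tail (n + 3)"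
proof -
  interpret L: bounded_linear L by (rule bounded_linear_Lambda)
  have u: "L ((b / real (j + 2)) *\<^sub>R unit1 (j + 2)) = tail (j + 2) - tail (j + 3)" for j
    unfolding L.scaleR Lambda_later_unit[OF le_add2] using b by (simp add: numeral_3_eq_3)
  have "tail 2 - (\<Sum>j=0..n. tail (j + 2) - tail (j + 3)) = tail (n + 3)"
  proof (induction n)
    case (Suc n)
    have "Suc n + 2 = n + 3" by simp
    then show ?case
      unfolding sum.atLeast0_atMost_Suc diff_diff_eq[symmetric] Suc.IH by (simp add: numeral_3_eq_3)
  qed (simp add: eval_nat_numeral)
  then show ?thesis unfolding L.sum u .
qed

end

section \<open>Choice of the parameters\<close>

text \<open>This is where the bound on \<open>M\<close> comes from. With \<open>t = 1 / M\<close> the first condition reads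
  \<open>2 \<delta>\<^sup>2 - (3 - t) \<delta> + 1 \<le> 0\<close>. Its left-hand side is least at \<open>\<delta> = (3 - t) / 4\<close>, and is nonpositive
  there if and only if \<open>(3 - t)\<^sup>2 \<ge> 8\<close>, which for \<open>t < 3\<close> means \<open>t \<le> 3 - 2 \<surd>2\<close>. The second condition
  then holds with room to spare.\<close>

lemma delta_conditions:
  fixes t :: real
  assumes t: "0 < t" "t \<le> 3 - 2 * sqrt 2"
  defines "\<delta> \<equiv> (3 - t) / 4"
  shows "0 < \<delta>" "\<delta> < 1" "(1 - \<delta>)\<^sup>2 + \<delta> * t \<le> \<delta> * (1 - \<delta>)"
    "(1 - \<delta> + \<delta> * t) * t \<le> \<delta> * (1 - \<delta>)"
proof -
  have t1: "t \<le> 1 / 4"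
    using t real_le_rsqrt[of "11 / 8" 2] by (simp add: power2_eq_square)
  show d: "0 < \<delta>" "\<delta> < 1" using t t1 by (auto simp: \<delta>_def)
  have "(2 * sqrt 2)\<^sup>2 \<le> (3 - t)\<^sup>2" using t by (intro power_mono) auto
  then have "8 \<le> (3 - t)\<^sup>2" by (simp add: power_mult_distrib)
  then show "(1 - \<delta>)\<^sup>2 + \<delta> * t \<le> \<delta> * (1 - \<delta>)"
    by (simp add: \<delta>_def power2_eq_square field_simps)
  \<comment> \<open>For \<open>t \<le> 1 / 4\<close> the cubic below, 16 times the gap in the second condition, is positive.\<close>
  have "t\<^sup>2 \<le> (1 / 4)\<^sup>2" using t t1 by (intro power_mono) auto
  then have "t\<^sup>2 \<le> 1 / 16" by (simp add: power_divide)
  moreover have "0 \<le> t ^ 3" using t by simp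
  ultimately have "0 \<le> 4 * t ^ 3 - 17 * t\<^sup>2 - 2 * t + 3" using t1 by linarith
  then show "(1 - \<delta> + \<delta> * t) * t \<le> \<delta> * (1 - \<delta>)"
    by (simp add: \<delta>_def power2_eq_square power3_eq_cube field_simps)
qed

theorem theorem2p4:
  fixes M \<alpha>0 :: real
  assumes "M \<ge> 1 / (3 - 2 * sqrt 2)" and "\<alpha>0 > 0"
  shows "\<exists>c0 b \<delta>. c0 > 0 \<and> b > 0 \<and> 0 < \<delta> \<and> \<delta> < 1 \<and>
    (let lam = (\<lambda>n. \<alpha>0 * M ^ n);
         L = Lambda M c0 b \<delta>;
         d = L (unit1 1);
         u = (\<lambda>j. (b / real (j + 2)) *\<^sub>R unit1 (j + 2));
         \<sigma> = (\<lambda>n. \<Sum>j=0..n. u j)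
     in bounded_linear L \<and>
        (\<forall>\<tau>. multiscale_sequence L d F_norm lam \<tau> \<longleftrightarrow> \<tau> = \<sigma>) \<and>
        (\<forall>v. is_minimizer (\<lambda>w. ereal (lam 0 * (norm (d - L w))\<^sup>2) + F_norm w) v \<longleftrightarrow> v = u 0) \<and>
        (\<forall>n\<ge>1. \<forall>v. is_minimizer (\<lambda>w. ereal (lam n * (norm (d - L (\<sigma> (n - 1) + w)))\<^sup>2) + F_norm w) v
                     \<longleftrightarrow> v = u n))"
proof -
  define t where "t = 1 / M"
  define \<delta> where "\<delta> = (3 - t) / 4"
  define c0 where "c0 = M ^ 3 / (4 * \<alpha>0)"
  define b where "b = \<delta> * (1 - \<delta>) / 2"
  have s: "3 - 2 * sqrt 2 > (0::real)"
    using real_sqrt_less_mono[of 2 "9/4"] by (simp add: real_sqrt_divide)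
  have M0: "M > 0" using assms(1) s by (meson divide_pos_pos less_le_trans zero_less_one)
  have t: "0 < t" "t \<le> 3 - 2 * sqrt 2"
    using M0 assms(1) s by (auto simp: t_def field_simps)
  have "t \<le> 1 / 2" using t real_le_rsqrt[of "5/4" 2] by (simp add: power2_eq_square)
  then have M2: "M \<ge> 2" using M0 by (simp add: t_def field_simps)
  note d = delta_conditions[OF t, folded \<delta>_def]
  have pos: "c0 > 0" "b > 0" using M0 assms(2) d by (auto simp: c0_def b_def)
  interpret example_operator M c0 b \<delta>
    by unfold_locales (use M2 d pos in auto)
  interpret L: bounded_linear L by (rule bounded_linear_Lambda)
  define lam where "lam = (\<lambda>n. \<alpha>0 * M ^ n)"
  define u where "u = (\<lambda>j. (b / real (j + 2)) *\<^sub>R unit1 (j + 2))"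
  define \<sigma> where "\<sigma> = (\<lambda>n. \<Sum>j=0..n. u j)"
  \<comment> \<open>The value of \<open>c0\<close> cancels \<open>\<alpha>0\<close> and the shift between \<open>M ^ n\<close> and \<open>M ^ (n + 3)\<close>. The common value
    \<open>1 / 2\<close> allows \<open>M / (M - 1) \<le> 2\<close> in the condition at \<open>e\<^sub>1\<close>, and \<open>b\<close> is chosen to match it.\<close>
  have q: "2 * lam n * (\<eta> (n + 2 + 1))\<^sup>2 = 1 / 2" for n
    using M0 assms(2) unfolding eta_squared
    by (simp add: lam_def c0_def power_add field_simps eval_nat_numeral)
  have min: "is_minimizer (\<lambda>w. ereal (lam n * (norm (tail (n + 2) - L w))\<^sup>2) + F_norm w) v \<longleftrightarrow> v = u n"
    for n v
    unfolding u_def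
  proof (rule minimizer_tail_iff)
    show "2 * lam n * (\<eta> (n + 2 + 1))\<^sup>2 * (\<delta> * (1 - \<delta>)) = b" unfolding q by (simp add: b_def)
    show "2 * lam n * (\<eta> (n + 2 + 1))\<^sup>2 * (M / (M - 1)) \<le> 1"
      unfolding q using M2 by (simp add: field_simps)
  qed (use d M0 assms(2) in \<open>auto simp: lam_def t_def\<close>)
  have min0: "is_minimizer (\<lambda>w. ereal (lam 0 * (norm (L (unit1 1) - L w))\<^sup>2) + F_norm w) v \<longleftrightarrow> v = u 0"
    for v
    unfolding Lambda_first_unit using min[of 0 v] by (simp only: add_0)
  have minn: "is_minimizer (\<lambda>w. ereal (lam n * (norm (L (unit1 1) - L (\<sigma> (n - 1) + w)))\<^sup>2) + F_norm w) v
      \<longleftrightarrow> v = u n" if "n \<ge> 1" for n v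
  proof -
    have "L (unit1 1) - L (\<sigma> (n - 1) + w) = tail (n + 2) - L w" for w
      using tail_sub_partial_sum[of "n - 1"] that Lambda_first_unit
      by (simp add: L.add \<sigma>_def u_def flip: diff_diff_eq)
    then show ?thesis using min[of n v] by simp
  qed
  have "multiscale_sequence L (L (unit1 1)) F_norm lam \<tau> \<longleftrightarrow> \<tau> = \<sigma>" for \<tau>
  proof (rule multiscale_sequence_unique)
    show "is_minimizer (\<lambda>w. ereal (lam 0 * (norm (L (unit1 1) - L w))\<^sup>2) + F_norm w) v \<longleftrightarrow> v = \<sigma> 0"
      for v unfolding min0 by (simp add: \<sigma>_def)
    fix n v assume n: "n \<ge> (1::nat)"
    have "\<sigma> n = \<sigma> (n - 1) + u n" using n by (cases n) (simp_all add: \<sigma>_def)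
    then show "is_minimizer (\<lambda>w. ereal (lam n * (norm (L (unit1 1) - L (\<sigma> (n - 1) + w)))\<^sup>2) + F_norm w) v
        \<longleftrightarrow> \<sigma> n = \<sigma> (n - 1) + v"
      unfolding minn[OF n] by auto
  qed
  then have "c0 > 0 \<and> b > 0 \<and> 0 < \<delta> \<and> \<delta> < 1 \<and> bounded_linear L
      \<and> (\<forall>\<tau>. multiscale_sequence L (L (unit1 1)) F_norm lam \<tau> \<longleftrightarrow> \<tau> = \<sigma>)
      \<and> (\<forall>v. is_minimizer
            (\<lambda>w. ereal (lam 0 * (norm (L (unit1 1) - L w))\<^sup>2) + F_norm w) v \<longleftrightarrow> v = u 0)
      \<and> (\<forall>n\<ge>1. \<forall>v. is_minimizer
            (\<lambda>w. ereal (lam n * (norm (L (unit1 1) - L (\<sigma> (n - 1) + w)))\<^sup>2) + F_norm w) v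
            \<longleftrightarrow> v = u n)"
    using pos d(1,2) min0 minn bounded_linear_Lambda by blast
  then show ?thesis
    unfolding Let_def lam_def \<sigma>_def u_def
    by - (rule exI[of _ c0], rule exI[of _ b], rule exI[of _ \<delta>], assumption)
qed

end
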